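(* Let $m\ge 2$ and let $a_1<\dots<a_m$ be real numbers. (1) There exists $\lambda_0=\lambda_0(a_1,\dots,a_m)<1$ such that for each $\lambda\in(\lambda_0,1)$ every $x\in\left(\frac{\lambda a_1}{1-\lambda},\frac{\lambda a_m}{1-\lambda}\right)$ has $2^{\aleph_0}$ expansions of the form $x=\sum_{n=1}^\infty\varepsilon_n\lambda^n$ with $\varepsilon_n\in\{a_1,\dots,a_m\}$ for all $n\ge1$. (2) If $\lambda\in(0,1)$ satisfies $$\max_{1\le j\le m-1}(a_{j+1}-a_j)<\frac{\lambda(a_m-a_1)}{1-\lambda},$$ then Lebesgue-almost every $x\in\left(\frac{\lambda a_1}{1-\lambda},\frac{\lambda a_m}{1-\lambda}\right)$ has $2^{\aleph_0}$ expansions of this form, and the exceptional set (of those $x$ in this interval which do not have $2^{\aleph_0}$ such expansions) has Hausdorff dimension strictly less than $1$.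
   Context: Expansions are identified with the digit sequences $(\varepsilon_n)_{n\ge1}\in\{a_1,\dots,a_m\}^{\mathbb{N}}$; two expansions are different if their digit sequences are different. *)

theory Defs
  imports "HOL-Analysis.Analysis"
begin

text \<open>
  Expansions are identified with their digit sequences.  Sequences are indexed from 0,
  so \<open>e n\<close> is the digit \<open>\<epsilon>\<^sub>n\<^sub>+\<^sub>1\<close>, which is weighted by \<open>l ^ (n + 1)\<close>.
\<close>

definition expansions :: "real set \<Rightarrow> real \<Rightarrow> real \<Rightarrow> (nat \<Rightarrow> real) set" where
  "expansions D l x = {e. (\<forall>n. e n \<in> D) \<and> (\<lambda>n. e n * l ^ Suc n) sums x}"

text \<open>
  The \<open>s\<close>-th power of the diameter (\<open>s \<ge> 0\<close>), with the usual conventions that the empty set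
  contributes 0 and that \<open>0\<^sup>0 = 1\<close> for nonempty sets.  The case \<open>s = 0\<close> is separate because
  \<open>0 powr 0 = 0\<close>.
\<close>

definition diam_pow :: "real \<Rightarrow> 'a::metric_space set \<Rightarrow> ennreal" where
  "diam_pow s U =
     (if U = {} then 0 else if s = 0 then 1 else ennreal (diameter U powr s))"

text \<open>
  Boundedness of the covering sets is required explicitly since \<open>diameter\<close> is real-valued and
  has no meaningful value on unbounded sets.  Finite covers are included, as the
  covering sets may be empty.
\<close>

definition hausdorff_premeasure :: "real \<Rightarrow> real \<Rightarrow> 'a::metric_space set \<Rightarrow> ennreal" where
  "hausdorff_premeasure d s E =
     (INF U \<in> {U :: nat \<Rightarrow> 'a set. E \<subseteq> (\<Union>i. U i) \<and> (\<forall>i. bounded (U i) \<and> diameter (U i) \<le> d)}.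
        \<Sum>i. diam_pow s (U i))"

definition hausdorff_measure :: "real \<Rightarrow> 'a::metric_space set \<Rightarrow> ennreal" where
  "hausdorff_measure s E = (SUP d \<in> {0<..}. hausdorff_premeasure d s E)"

definition hausdorff_dim :: "'a::metric_space set \<Rightarrow> ennreal" where
  "hausdorff_dim E = (INF s \<in> {s. 0 \<le> s \<and> hausdorff_measure s E = 0}. ennreal s)"

end

theory Submission
  imports Defs
begin

text \<open>
  Put \<open>L = l a\<^sub>1 / (1 - l)\<close>, \<open>R = l a\<^sub>m / (1 - l)\<close> and \<open>G = (L, R)\<close>.  Choosing a first digit \<open>d\<close> for \<open>x\<close>
  leaves the remainder \<open>x / l - d\<close> to be expanded, and a digit sequence is an expansion of \<open>x\<close> as
  soon as its successive remainders return infinitely often to a bounded set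
  (\<open>sums_if_remainders_recur\<close>).  Call \<open>y\<close> branching if two different digits keep the remainder
  in \<open>G\<close>.  If a branching point can be reached from every remainder of \<open>x\<close> in \<open>G\<close>, then the
  admissible digit words contain a complete binary tree, and \<open>x\<close> has continuum many expansions
  (\<open>continuum_expansions\<close>).

  For the first claim the digits \<open>a\<^sub>1\<close> and \<open>a\<^sub>m\<close> suffice: \<open>y\<close> is branching unless it is
  within \<open>W = l (a\<^sub>m - a\<^sub>1)\<close> of \<open>L\<close> or of \<open>R\<close>.  Near \<open>L\<close> the digit \<open>a\<^sub>1\<close>, near \<open>R\<close> the digit
  \<open>a\<^sub>m\<close>, multiplies the distance to that endpoint by \<open>1 / l\<close>; when \<open>l + l\<^sup>2 > 1\<close> such a step cannot
  jump over the middle part, so the middle part is reached (\<open>reach_branching_two_digits\<close>).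

  For the second claim let \<open>E\<close> be the set of points of \<open>G\<close> from which no branching point can be
  reached.  A point without continuum many expansions has a remainder in \<open>E\<close>, so the exceptional
  set is covered by countably many contracted copies of \<open>E\<close> (\<open>exceptional_subset\<close>).  The
  hypothesis on the gaps says that the intervals \<open>l (G + a\<^sub>j)\<close> with consecutive \<open>j\<close> overlap, and
  overlap points are branching, hence outside \<open>E\<close>.  Any subinterval of \<open>G\<close> can be magnified by
  the maps \<open>y \<mapsto> y / l - a\<^sub>j\<close> until it no longer fits into a single \<open>l (G + a\<^sub>j)\<close>; then
  it contains a whole overlap, and pulling that back gives a hole of \<open>E\<close> whose share of the
  original interval is bounded below (\<open>branchless_porous\<close>).  Removing such holes again and again
  shows that \<open>E\<close> has Hausdorff measure zero for some exponent \<open>s < 1\<close>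
  (\<open>porous_hausdorff_null\<close>).  This passes to the exceptional set, which therefore has dimension
  at most \<open>s\<close> and, as \<open>s \<le> 1\<close>, Lebesgue measure zero.
\<close>

section \<open>Null sets of Hausdorff measures\<close>

lemma hausdorff_premeasure_le:
  assumes "E \<subseteq> (\<Union>i. U i)" "\<And>i. bounded (U i)" "\<And>i. diameter (U i) \<le> d"
  shows "hausdorff_premeasure d s E \<le> (\<Sum>i. diam_pow s (U i))"
  unfolding hausdorff_premeasure_def using assms by (intro INF_lower) auto

lemma hausdorff_premeasure_mono:
  "A \<subseteq> B \<Longrightarrow> hausdorff_premeasure d s A \<le> hausdorff_premeasure d s B"
  unfolding hausdorff_premeasure_def by (rule INF_superset_mono) auto

lemma hausdorff_premeasure_empty:
  assumes "0 \<le> d" shows "hausdorff_premeasure d s {} = 0"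
  using hausdorff_premeasure_le[of "{}" "\<lambda>_. {}" d s] assms by (simp add: diam_pow_def diameter_def)

lemma hausdorff_premeasure_le_diam_pow:
  assumes "bounded U" "diameter U \<le> d" "0 \<le> d"
  shows "hausdorff_premeasure d s U \<le> diam_pow s U"
proof -
  let ?U = "\<lambda>i::nat. if i = 0 then U else {}"
  have "hausdorff_premeasure d s U \<le> (\<Sum>i. diam_pow s (?U i))"
    by (rule hausdorff_premeasure_le) (use assms in \<open>auto simp: diameter_def split: if_splits\<close>)
  also have "\<dots> = (\<Sum>i\<in>{0}. diam_pow s (?U i))"
    by (rule suminf_finite) (auto simp: diam_pow_def)
  finally show ?thesis by simp
qed

text \<open>
  Choose for the \<open>n\<close>-th set a cover that is optimal up to \<open>e / 2\<^sup>n\<^sup>+\<^sup>1\<close>, and enumerate all covering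
  sets by the pairing function.
\<close>

lemma hausdorff_premeasure_UN_le:
  "hausdorff_premeasure d s (\<Union>n. A n) \<le> (\<Sum>n::nat. hausdorff_premeasure d s (A n))"
proof (rule ennreal_le_epsilon)
  fix e :: real
  let ?O = "hausdorff_premeasure d s"
  assume e: "0 < e" and fin: "(\<Sum>n. ?O (A n)) < top"
  have "\<exists>U. A n \<subseteq> (\<Union>i. U i) \<and> (\<forall>i. bounded (U i) \<and> diameter (U i) \<le> d) \<and>
            (\<Sum>i. diam_pow s (U i)) \<le> ?O (A n) + ennreal (e * (1/2) ^ Suc n)" for n
  proof -
    have "?O (A n) \<noteq> \<infinity>"
      using ennreal_suminf_lessD[OF fin, of n] by auto
    from INF_approx_ennreal[OF _ hausdorff_premeasure_def this, of "e * (1/2) ^ Suc n"] e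
    show ?thesis by (auto intro: less_imp_le)
  qed
  then obtain U where U: "\<And>n. A n \<subseteq> (\<Union>i. U n i)" "\<And>n i. bounded (U n i)"
      "\<And>n i. diameter (U n i) \<le> d"
      "\<And>n. (\<Sum>i. diam_pow s (U n i)) \<le> ?O (A n) + ennreal (e * (1/2) ^ Suc n)"
    by metis
  define C where "C = case_prod U \<circ> prod_decode"
  have "(\<Union>n. A n) \<subseteq> (\<Union>i. C i)"
    using U(1) by (auto simp: C_def subset_eq) (metis prod.case prod_encode_inverse)
  then have "?O (\<Union>n. A n) \<le> (\<Sum>i. diam_pow s (C i))"
    by (rule hausdorff_premeasure_le) (auto simp: C_def U split: prod.split)
  also have "\<dots> = (\<Sum>n. \<Sum>i. diam_pow s (U n i))"
    unfolding C_def comp_def by (intro suminf_ennreal_2dimen) auto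
  also have "\<dots> \<le> (\<Sum>n. ?O (A n) + ennreal (e * (1/2) ^ Suc n))"
    by (intro suminf_le U) auto
  also have "\<dots> = (\<Sum>n. ?O (A n)) + (\<Sum>n. ennreal e * ennreal ((1/2) ^ Suc n))"
    using e by (subst suminf_add[symmetric])
               (auto simp del: ennreal_suminf_cmult simp add: ennreal_mult[symmetric])
  also have "\<dots> = (\<Sum>n. ?O (A n)) + e"
    unfolding ennreal_suminf_cmult
    by (subst suminf_ennreal_eq[OF zero_le_power power_half_series]) auto
  finally show "?O (\<Union>n. A n) \<le> (\<Sum>n. ?O (A n)) + ennreal e" .
qed

lemma hausdorff_premeasure_Un_le:
  assumes "0 \<le> d"
  shows "hausdorff_premeasure d s (A \<union> B) \<le> hausdorff_premeasure d s A + hausdorff_premeasure d s B"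
proof -
  let ?C = "\<lambda>n::nat. if n = 0 then A else if n = 1 then B else {}"
  have "A \<union> B \<subseteq> (\<Union>n. ?C n)"
    by (auto split: if_splits)
  then have "hausdorff_premeasure d s (A \<union> B) \<le> (\<Sum>n. hausdorff_premeasure d s (?C n))"
    using hausdorff_premeasure_mono hausdorff_premeasure_UN_le order_trans by blast
  also have "\<dots> = (\<Sum>n\<in>{0,1}. hausdorff_premeasure d s (?C n))"
    by (rule suminf_finite) (auto simp: hausdorff_premeasure_empty assms)
  finally show ?thesis by simp
qed

lemma hausdorff_measure_eq_0_iff:
  "hausdorff_measure s E = 0 \<longleftrightarrow> (\<forall>d>0. hausdorff_premeasure d s E = 0)"
  unfolding hausdorff_measure_def
  using SUP_bot_conv(1)[of "\<lambda>d. hausdorff_premeasure d s E" "{0<..}"] by (simp add: bot_ennreal Ball_def)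

lemma hausdorff_measure_null_mono:
  assumes "hausdorff_measure s B = 0" "A \<subseteq> B"
  shows "hausdorff_measure s A = 0"
  unfolding hausdorff_measure_eq_0_iff
proof (intro allI impI)
  fix d :: real assume "d > 0"
  then have "hausdorff_premeasure d s B = 0"
    using assms(1) by (simp add: hausdorff_measure_eq_0_iff)
  then show "hausdorff_premeasure d s A = 0"
    using hausdorff_premeasure_mono[OF assms(2), of d s] by simp
qed

lemma hausdorff_measure_null_UN:
  assumes "countable I" "\<And>i. i \<in> I \<Longrightarrow> hausdorff_measure s (A i) = 0"
  shows "hausdorff_measure s (\<Union>i\<in>I. A i) = 0"
proof (cases "I = {}")
  case True
  then show ?thesis
    by (simp add: hausdorff_measure_eq_0_iff hausdorff_premeasure_empty)
next
  case False
  then obtain f :: "nat \<Rightarrow> _" where f: "range f = I"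
    using assms(1) by (metis range_from_nat_into)
  have "hausdorff_premeasure d s (\<Union>n. A (f n)) = 0" if "d > 0" for d
  proof -
    have "hausdorff_premeasure d s (A (f n)) = 0" for n
      using assms(2) f that unfolding hausdorff_measure_eq_0_iff by blast
    then show ?thesis
      using hausdorff_premeasure_UN_le[of d s "\<lambda>n. A (f n)"] by simp
  qed
  moreover have "(\<Union>i\<in>I. A i) = (\<Union>n. A (f n))"
    using f by auto
  ultimately show ?thesis
    by (simp add: hausdorff_measure_eq_0_iff)
qed

lemma hausdorff_measure_null_nonexpansive_image:
  fixes f :: "'a::metric_space \<Rightarrow> 'b::metric_space"
  assumes f: "\<And>x y. dist (f x) (f y) \<le> dist x y" and s: "0 \<le> s" and E: "hausdorff_measure s E = 0"
  shows "hausdorff_measure s (f ` E) = 0"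
proof -
  have bd: "bounded (f ` V)" if "bounded V" for V
  proof -
    obtain x e where "\<forall>y\<in>V. dist x y \<le> e"
      using \<open>bounded V\<close> unfolding bounded_def by blast
    then show ?thesis
      unfolding bounded_def by (intro exI[of _ "f x"] exI[of _ e]) (use f order_trans in blast)
  qed
  have diam: "diameter (f ` V) \<le> diameter V" if "bounded V" for V
  proof (cases "V = {}")
    case False
    then have "(SUP (x,y)\<in>f ` V \<times> f ` V. dist x y) \<le> diameter V"
      using order_trans[OF f diameter_bounded_bound[OF that]] by (intro cSUP_least) auto
    then show ?thesis using False by (simp add: diameter_def)
  qed simp
  have "hausdorff_premeasure d s (f ` E) \<le> hausdorff_premeasure d s E" for d
    unfolding hausdorff_premeasure_def[of d s E]
  proof (rule INF_greatest)
    fix U :: "nat \<Rightarrow> 'a set"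
    assume "U \<in> {U. E \<subseteq> (\<Union>i. U i) \<and> (\<forall>i. bounded (U i) \<and> diameter (U i) \<le> d)}"
    then have U: "E \<subseteq> (\<Union>i. U i)" "\<And>i. bounded (U i)" "\<And>i. diameter (U i) \<le> d" by auto
    have "hausdorff_premeasure d s (f ` E) \<le> (\<Sum>i. diam_pow s (f ` U i))"
    proof (rule hausdorff_premeasure_le)
      show "f ` E \<subseteq> (\<Union>i. f ` U i)" using U(1) by blast
      show "diameter (f ` U i) \<le> d" for i
        using diam[OF U(2)] U(3) by (rule order_trans)
    qed (use U bd in auto)
    also have "\<dots> \<le> (\<Sum>i. diam_pow s (U i))"
      by (intro suminf_le)
         (use U diam s in \<open>auto simp: diam_pow_def intro!: ennreal_leI powr_mono2 diameter_ge_0 bd\<close>)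
    finally show "hausdorff_premeasure d s (f ` E) \<le> (\<Sum>i. diam_pow s (U i))" .
  qed
  then show ?thesis
    using E unfolding hausdorff_measure_eq_0_iff by (metis le_zero_eq)
qed

text \<open>
  For sets of diameter \<open>\<delta> \<le> 1\<close> one has \<open>\<delta> \<le> \<delta>\<^sup>s\<close>, so a cover that is cheap for the
  exponent \<open>s\<close> gives, after replacing each set by a ball of radius \<open>\<delta>\<close> around one of its points,
  a measurable cover of at most twice that cost.
\<close>

lemma negligible_if_hausdorff_measure_null:
  fixes E :: "real set"
  assumes "0 < s" "s \<le> 1" and E: "hausdorff_measure s E = 0"
  shows "negligible E"
  unfolding negligible_outer_le
proof safe
  fix e :: real assume e: "e > 0"
  have "hausdorff_premeasure 1 s E = 0"
    using E by (simp add: hausdorff_measure_eq_0_iff)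
  then have "hausdorff_premeasure 1 s E < ennreal (e/2)"
    using e by simp
  then obtain U where U: "E \<subseteq> (\<Union>i. U i)" "\<And>i. bounded (U i)" "\<And>i. diameter (U i) \<le> 1"
      and Ue: "(\<Sum>i. diam_pow s (U i)) < ennreal (e/2)"
    unfolding hausdorff_premeasure_def INF_less_iff by auto
  define B where "B i = (if U i = {} then {} else cball (SOME x. x \<in> U i) (diameter (U i)))" for i
  have UB: "U i \<subseteq> B i" for i
  proof (cases "U i = {}")
    case False
    then have "(SOME x. x \<in> U i) \<in> U i" by (simp add: some_in_eq)
    then show ?thesis
      using diameter_bounded_bound[OF U(2)] by (auto simp: B_def)
  qed simp
  have "emeasure lborel (B i) \<le> 2 * diam_pow s (U i)" for i
  proof (cases "U i = {}")
    case False
    let ?d = "diameter (U i)"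
    have d: "0 \<le> ?d" by (rule diameter_ge_0[OF U(2)])
    have "?d \<le> ?d powr s"
      using powr_mono'[of s 1 ?d] assms d U(3)[of i] by (cases "?d = 0") auto
    moreover have "emeasure lborel (B i) = ennreal (2 * ?d)"
      using False d by (simp add: B_def cball_eq_atLeastAtMost)
    ultimately show ?thesis
      using False d assms(1) by (simp add: diam_pow_def ennreal_mult ennreal_leI mult_left_mono)
  qed (simp add: B_def)
  then have "(\<Sum>i. emeasure lborel (B i)) \<le> (\<Sum>i. 2 * diam_pow s (U i))"
    by (intro suminf_le) auto
  also have "\<dots> \<le> 2 * ennreal (e/2)"
    using Ue by (simp add: mult_left_mono)
  also have "\<dots> = ennreal e"
    using e by (simp flip: ennreal_mult ennreal_numeral)
  finally have "(\<Sum>i. emeasure lborel (B i)) \<le> ennreal e" .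
  moreover have Bm: "range B \<subseteq> sets lborel" by (auto simp: B_def)
  ultimately have le: "emeasure lborel (\<Union>i. B i) \<le> ennreal e"
    using emeasure_subadditive_countably[OF Bm] order_trans by blast
  have sB: "(\<Union>i. B i) \<in> sets lborel" using Bm by blast
  have "emeasure lebesgue (\<Union>i. B i) \<le> ennreal e"
    using le sB by simp
  then have "(\<Union>i. B i) \<in> lmeasurable" "measure lebesgue (\<Union>i. B i) \<le> e"
    using sB e by (auto intro!: fmeasurableI simp: measure_def enn2real_leI)
       (use ennreal_less_top le_less_trans in blast)
  then show "\<exists>T. E \<subseteq> T \<and> T \<in> lmeasurable \<and> measure lebesgue T \<le> e"
    using U(1) UB by (intro exI[of _ "\<Union>i. B i"]) blast
qed

section \<open>Porous sets of reals\<close>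

text \<open>
  This is concavity of \<open>t \<mapsto> t\<^sup>s\<close>, obtained by applying Young's inequality to \<open>x\<close> and \<open>K\<close> and
  to \<open>y\<close> and \<open>K\<close>: the tangent at \<open>K\<close> dominates the power.
\<close>

lemma sum_powr_le:
  fixes x y K s :: real
  assumes "0 < x" "0 < y" "x + y \<le> 2 * K" "0 \<le> s" "s \<le> 1"
  shows "x powr s + y powr s \<le> 2 * K powr s"
proof -
  have K: "K > 0" using assms by simp
  have "x powr s * K powr (1 - s) + y powr s * K powr (1 - s)
          \<le> (s * x + (1 - s) * K) + (s * y + (1 - s) * K)"
    using Youngs_inequality_0[of s "1 - s" x K] Youngs_inequality_0[of s "1 - s" y K] assms K
    by (intro add_mono) auto
  also have "\<dots> = s * (x + y) + (1 - s) * (2 * K)" by (simp add: algebra_simps)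
  also have "\<dots> \<le> s * (2 * K) + (1 - s) * (2 * K)"
    using assms by (intro add_mono mult_left_mono) auto
  also have "\<dots> = 2 * K powr s * K powr (1 - s)"
    using K by (simp add: algebra_simps flip: powr_add)
  finally have "(x powr s + y powr s) * K powr (1 - s) \<le> (2 * K powr s) * K powr (1 - s)"
    by (simp add: algebra_simps)
  then show ?thesis using K by (simp add: mult_le_cancel_right)
qed

text \<open>
  At \<open>s = 1\<close> the left-hand side equals \<open>r < 1\<close>, and it is continuous in \<open>s\<close>.
\<close>

lemma exponent_below_1:
  fixes r :: real assumes "0 < r" "r < 1"
  shows "\<exists>s. 0 < s \<and> s < 1 \<and> 2 * (r / 2) powr s < 1"
proof -
  have "((\<lambda>s. 2 * (r / 2) powr s) \<longlongrightarrow> 2 * (r / 2) powr 1) (at_left 1)"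
    using assms by (intro tendsto_intros) auto
  then have "\<forall>\<^sub>F s in at_left 1. 2 * (r / 2) powr s < 1"
    by (rule order_tendstoD) (use assms in auto)
  moreover have "\<forall>\<^sub>F s in at_left (1::real). s \<in> {0<..<1}"
    by (rule eventually_at_left_real) simp
  ultimately have "\<forall>\<^sub>F s in at_left (1::real). 0 < s \<and> s < 1 \<and> 2 * (r / 2) powr s < 1"
    by eventually_elim auto
  then show ?thesis
    using eventually_happens' trivial_limit_at_left_real by blast
qed

text \<open>
  Cutting a hole out of an interval leaves two intervals whose lengths add up to at most \<open>1 - c\<close>
  times the original one.  By concavity the sum of the \<open>s\<close>-th powers of the lengths then drops by the
  factor \<open>t = 2 ((1 - c) / 2)\<^sup>s\<close>, which is below 1 for \<open>s\<close> close to 1.  After \<open>n\<close> rounds the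
  \<open>2\<^sup>n\<close> remaining intervals cost at most \<open>t\<^sup>n\<close> times the initial cost; in particular each of them is
  short, so the cover is admissible for any prescribed mesh \<open>d\<close>.
\<close>

lemma porous_hausdorff_null:
  fixes E :: "real set" and c L R :: real
  assumes c: "0 < c" "c < 1"
    and hole: "\<And>u v. L \<le> u \<Longrightarrow> u < v \<Longrightarrow> v \<le> R \<Longrightarrow>
       \<exists>p q. u < p \<and> q < v \<and> c * (v - u) \<le> q - p \<and> {p..q} \<inter> E = {}"
  shows "\<exists>s. 0 < s \<and> s < 1 \<and> hausdorff_measure s (E \<inter> {L<..<R}) = 0"
proof -
  obtain s where s: "0 < s" "s < 1" and less1: "2 * ((1 - c) / 2) powr s < 1"
    using exponent_below_1[of "1 - c"] c by auto
  define t where "t = 2 * ((1 - c) / 2) powr s"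
  have t: "0 \<le> t" "t < 1" using less1 by (auto simp: t_def)
  have split: "hausdorff_premeasure d s (E \<inter> {u<..<v}) \<le> ennreal (t ^ n * (v - u) powr s)"
    if "0 < d" "L \<le> u" "u < v" "v \<le> R" "t ^ n * (v - u) powr s \<le> d powr s" for d n u v
    using that(2-)
  proof (induction n arbitrary: u v)
    case 0
    then have "v - u \<le> d"
      using powr_le_cancel_iff powr_mono2[of s d "v - u"] s that(1)
      by (metis linorder_not_le mult_1 power_0 powr_less_mono2 less_imp_le)
    have bnd: "bounded (E \<inter> {u<..<v})" by (intro bounded_Int) auto
    have diam: "diameter (E \<inter> {u<..<v}) \<le> v - u"
      using 0 by (intro diameter_le) auto
    have "hausdorff_premeasure d s (E \<inter> {u<..<v}) \<le> diam_pow s (E \<inter> {u<..<v})"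
      using bnd diam \<open>v - u \<le> d\<close> that(1) by (intro hausdorff_premeasure_le_diam_pow) auto
    also have "\<dots> \<le> ennreal ((v - u) powr s)"
      using s diam by (auto simp: diam_pow_def intro!: ennreal_leI powr_mono2 diameter_ge_0[OF bnd])
    finally show ?case by simp
  next
    case (Suc n)
    obtain p q where pq: "u < p" "q < v" "c * (v - u) \<le> q - p" "{p..q} \<inter> E = {}"
      using hole[of u v] Suc.prems by blast
    have "p < q"
      using pq(3) c Suc.prems(2) by (smt (verit) mult_pos_pos)
    have "(p - u) + (v - q) \<le> 2 * ((1 - c) / 2 * (v - u))"
      using pq by (simp add: algebra_simps)
    then have "(p - u) powr s + (v - q) powr s \<le> 2 * ((1 - c) / 2 * (v - u)) powr s"
      using pq s by (intro sum_powr_le) auto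
    also have "\<dots> = t * (v - u) powr s"
      using c Suc.prems by (subst powr_mult) (auto simp: t_def)
    finally have sum: "t ^ n * (p - u) powr s + t ^ n * (v - q) powr s \<le> t ^ Suc n * (v - u) powr s"
      using mult_left_mono[of _ _ "t ^ n"] t by (fastforce simp: algebra_simps)
    have "0 \<le> t ^ n * (p - u) powr s" "0 \<le> t ^ n * (v - q) powr s" using t by auto
    then have small: "t ^ n * (p - u) powr s \<le> d powr s" "t ^ n * (v - q) powr s \<le> d powr s"
      using sum Suc.prems(4) by linarith+
    have "E \<inter> {u<..<v} \<subseteq> (E \<inter> {u<..<p}) \<union> (E \<inter> {q<..<v})"
    proof
      fix x assume "x \<in> E \<inter> {u<..<v}"
      moreover from this pq(4) have "x < p \<or> q < x" by (auto simp: disjoint_iff not_less)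
      ultimately show "x \<in> (E \<inter> {u<..<p}) \<union> (E \<inter> {q<..<v})" by auto
    qed
    then have "hausdorff_premeasure d s (E \<inter> {u<..<v})
        \<le> hausdorff_premeasure d s (E \<inter> {u<..<p}) + hausdorff_premeasure d s (E \<inter> {q<..<v})"
      using hausdorff_premeasure_mono hausdorff_premeasure_Un_le that(1) less_imp_le order_trans
      by meson
    also have "\<dots> \<le> ennreal (t ^ n * (p - u) powr s) + ennreal (t ^ n * (v - q) powr s)"
      using pq \<open>p < q\<close> Suc.prems small by (intro add_mono Suc.IH) auto
    also have "\<dots> \<le> ennreal (t ^ Suc n * (v - u) powr s)"
      using sum t by (simp flip: ennreal_plus add: ennreal_leI)
    finally show ?case .
  qed
  have "hausdorff_premeasure d s (E \<inter> {L<..<R}) = 0" if d: "d > 0" for d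
  proof (cases "L < R")
    case True
    have lim: "(\<lambda>n. t ^ n * (R - L) powr s) \<longlonglongrightarrow> 0"
      using t by (intro tendsto_mult_left_zero LIMSEQ_power_zero) auto
    have "\<forall>\<^sub>F n in sequentially. t ^ n * (R - L) powr s < d powr s"
      using lim by (rule order_tendstoD) (use d in auto)
    then have "\<forall>\<^sub>F n in sequentially.
        hausdorff_premeasure d s (E \<inter> {L<..<R}) \<le> ennreal (t ^ n * (R - L) powr s)"
      by eventually_elim (use split d True in auto)
    then have "hausdorff_premeasure d s (E \<inter> {L<..<R}) \<le> ennreal 0"
      using tendsto_ennrealI[OF lim] by (intro tendsto_lowerbound) auto
    then show ?thesis by simp
  next
    case False
    then have "E \<inter> {L<..<R} = {}" by auto
    then show ?thesis using d by (simp only: hausdorff_premeasure_empty)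
  qed
  then show ?thesis
    using s by (auto simp: hausdorff_measure_eq_0_iff)
qed

section \<open>Trees of finite words\<close>

text \<open>
  A set of words in which every word has two different extensions of the same length contains a
  complete binary tree, and each set \<open>F\<close> of naturals selects a branch: at level \<open>k\<close> it turns
  according to whether \<open>k \<in> F\<close>.  Equal lengths make different branches disagree at an actual position
  of the limiting sequences, instead of one node merely being a prefix of the other.
\<close>

lemma split_tree_lepoll:
  fixes Q :: "'a list set"
  assumes w0: "w0 \<in> Q"
    and split: "\<And>w. w \<in> Q \<Longrightarrow> \<exists>u v. length u = length v \<and> u \<noteq> v \<and> w @ u \<in> Q \<and> w @ v \<in> Q"
  shows "(UNIV :: nat set set) \<lesssim> {e. \<forall>k. \<exists>n\<ge>k. map e [0..<n] \<in> Q}"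
proof -
  obtain p q where p: "\<And>w. w \<in> Q \<Longrightarrow> length (p w) = length (q w) \<and> p w \<noteq> q w \<and> w @ p w \<in> Q \<and> w @ q w \<in> Q"
    using split by metis
  define ext where "ext w b = w @ (if b then p w else q w)" for w and b :: bool
  define node where "node F = rec_nat w0 (\<lambda>i w. ext w (i \<in> F))" for F :: "nat set"
  have node_0: "node F 0 = w0" and node_Suc: "node F (Suc k) = ext (node F k) (k \<in> F)" for F k
    by (simp_all add: node_def)
  have node_Q: "node F k \<in> Q" for F k
    by (induction k) (use w0 p in \<open>auto simp: node_0 node_Suc ext_def\<close>)
  have node_less: "length (node F k) < length (node F (Suc k))" for F k
  proof -
    have "p (node F k) \<noteq> [] \<and> q (node F k) \<noteq> []"
      using p[OF node_Q] by (metis length_0_conv)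
    then show ?thesis by (simp add: node_Suc ext_def)
  qed
  have node_length: "k \<le> length (node F k)" for F k
  proof (induction k)
    case (Suc k)
    then show ?case using node_less[of F k] by linarith
  qed simp
  have node_prefix: "\<exists>w. node F k = node F j @ w" if "j \<le> k" for F j k
    using that by (induction k rule: dec_induct) (auto simp: node_Suc ext_def)
  define e where "e F n = node F (Suc n) ! n" for F n
  have e_node: "map (e F) [0..<length (node F k)] = node F k" for F k
  proof (rule nth_equalityI)
    fix n assume "n < length (map (e F) [0..<length (node F k)])"
    then have n: "n < length (node F k)" by simp
    have n': "n < length (node F (Suc n))" using node_length[of "Suc n" F] by simp
    have "node F (Suc n) ! n = node F k ! n"
      using node_prefix[of "Suc n" k F] node_prefix[of k "Suc n" F] n n'
      by (cases "Suc n \<le> k") (auto simp: nth_append)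
    then show "map (e F) [0..<length (node F k)] ! n = node F k ! n"
      using n by (simp add: e_def)
  qed simp
  have "inj e"
  proof (rule injI, rule ccontr)
    fix F G assume eq: "e F = e G" and "F \<noteq> G"
    then have "\<exists>k. (k \<in> F) \<noteq> (k \<in> G)" by blast
    define k where "k = (LEAST k. (k \<in> F) \<noteq> (k \<in> G))"
    have k: "(k \<in> F) \<noteq> (k \<in> G)"
      unfolding k_def by (rule LeastI_ex) fact
    have same: "node F i = node G i" if "i \<le> k" for i
      using that
    proof (induction i)
      case (Suc i)
      then have "i < (LEAST k. (k \<in> F) \<noteq> (k \<in> G))" by (simp add: k_def)
      from not_less_Least[OF this] have "(i \<in> F) = (i \<in> G)" by blast
      then show ?case using Suc by (simp add: node_Suc)
    qed (simp add: node_0)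
    have "length (node F (Suc k)) = length (node G (Suc k))" "node F (Suc k) \<noteq> node G (Suc k)"
      using k same[of k] p[OF node_Q[of F k]] by (auto simp: node_Suc ext_def)
    then show False
      using e_node[of F "Suc k"] e_node[of G "Suc k"] eq by simp
  qed
  moreover have "\<exists>n\<ge>k. map (e F) [0..<n] \<in> Q" for F k
    using node_length e_node node_Q by metis
  ultimately show ?thesis
    unfolding lepoll_def by (intro exI[of _ e]) auto
qed

text \<open>
  A sequence is coded by its graph, which is a subset of the countable set of pairs of a position
  and a digit.
\<close>

lemma sequences_lepoll:
  assumes "countable D"
  shows "{e :: nat \<Rightarrow> 'a. \<forall>n. e n \<in> D} \<lesssim> (UNIV :: nat set set)"
  unfolding lepoll_def
proof (intro exI[of _ "\<lambda>e. range (\<lambda>n. prod_encode (n, to_nat_on D (e n)))"] conjI inj_onI ext)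
  fix e f :: "nat \<Rightarrow> 'a" and n
  assume D: "e \<in> {e. \<forall>n. e n \<in> D}" "f \<in> {e. \<forall>n. e n \<in> D}"
    and eq: "range (\<lambda>n. prod_encode (n, to_nat_on D (e n))) = range (\<lambda>n. prod_encode (n, to_nat_on D (f n)))"
  then have "prod_encode (n, to_nat_on D (e n)) \<in> range (\<lambda>n. prod_encode (n, to_nat_on D (f n)))"
    by blast
  then have "to_nat_on D (e n) = to_nat_on D (f n)" by auto
  then show "e n = f n" using D assms by simp
qed simp

section \<open>Remainders and branching\<close>

definition remainder :: "real \<Rightarrow> real \<Rightarrow> real list \<Rightarrow> real" where
  "remainder l = foldl (\<lambda>x d. x / l - d)"

lemma remainder_simps [simp]:
  "remainder l x [] = x" "remainder l x (d # w) = remainder l (x / l - d) w"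
  "remainder l x (v @ w) = remainder l (remainder l x v) w"
  by (simp_all add: remainder_def)

text \<open>
  The remainder is what the word fails to represent, scaled back by the weight of its last digit.
\<close>

lemma remainder_eq:
  assumes "l \<noteq> 0"
  shows "x = (\<Sum>n<length w. w ! n * l ^ Suc n) + l ^ length w * remainder l x w"
proof (induction w rule: rev_induct)
  case (snoc d w)
  have "(\<Sum>n<length w. (w @ [d]) ! n * l ^ Suc n) = (\<Sum>n<length w. w ! n * l ^ Suc n)"
    by (intro sum.cong) (auto simp: nth_append)
  then have "(\<Sum>n<length (w @ [d]). (w @ [d]) ! n * l ^ Suc n) + l ^ length (w @ [d]) * remainder l x (w @ [d])
     = (\<Sum>n<length w. w ! n * l ^ Suc n) + l ^ length w * remainder l x w"
    using assms by (simp add: field_simps)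
  then show ?case using snoc by simp
qed simp

text \<open>
  The error of the \<open>N\<close>-th partial sum is \<open>l\<^sup>N\<close> times the \<open>N\<close>-th remainder.  It is small along the
  positions where the remainder is in the bounded set; the series converges because its digits are
  bounded, so its limit is determined by these positions.
\<close>

lemma sums_if_remainders_recur:
  assumes l: "0 < l" "l < 1" and D: "finite D" "\<And>n. e n \<in> D"
    and G: "\<And>y. y \<in> G \<Longrightarrow> \<bar>y\<bar> \<le> C"
    and recur: "\<And>k. \<exists>n\<ge>k. remainder l x (map e [0..<n]) \<in> G"
  shows "(\<lambda>n. e n * l ^ Suc n) sums x"
proof -
  let ?S = "\<lambda>N. \<Sum>n<N. e n * l ^ Suc n"
  obtain M where M: "\<And>d. d \<in> D \<Longrightarrow> \<bar>d\<bar> \<le> M"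
    using finite_imp_bounded[OF D(1)] by (auto simp: bounded_iff)
  have "summable (\<lambda>n. e n * l ^ Suc n)"
  proof (rule summable_comparison_test')
    show "summable (\<lambda>n. M * l ^ Suc n)"
      using l by (intro summable_mult summable_ignore_initial_segment[of _ 1, simplified] summable_geometric) auto
    show "norm (e n * l ^ Suc n) \<le> M * l ^ Suc n" for n
      using M[OF D(2)] l by (simp add: abs_mult mult_right_mono)
  qed
  then obtain s where s: "(\<lambda>n. e n * l ^ Suc n) sums s" by blast
  have lim: "(\<lambda>N. \<bar>?S N - x\<bar> - C * l ^ N) \<longlonglongrightarrow> \<bar>s - x\<bar> - C * 0"
    using s l unfolding sums_def by (intro tendsto_intros LIMSEQ_power_zero) auto
  have freq: "\<exists>\<^sub>F N in sequentially. \<bar>?S N - x\<bar> - C * l ^ N \<le> 0"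
    unfolding frequently_sequentially
  proof
    fix k
    obtain N where N: "N \<ge> k" "remainder l x (map e [0..<N]) \<in> G" using recur by blast
    have "x = ?S N + l ^ N * remainder l x (map e [0..<N])"
      using remainder_eq[of l x "map e [0..<N]"] l by simp
    then have "\<bar>?S N - x\<bar> = l ^ N * \<bar>remainder l x (map e [0..<N])\<bar>"
      using l by (metis abs_minus_commute abs_mult abs_of_nonneg add_diff_cancel_left' zero_le_power less_imp_le)
    also have "\<dots> \<le> C * l ^ N"
      using G[OF N(2)] l by (simp add: mult.commute mult_left_mono)
    finally show "\<exists>N\<ge>k. \<bar>?S N - x\<bar> - C * l ^ N \<le> 0" using N(1) by auto
  qed
  have "s = x"
  proof (rule ccontr)
    assume "s \<noteq> x"
    then have "\<forall>\<^sub>F N in sequentially. \<bar>?S N - x\<bar> - C * l ^ N > 0"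
      by (intro order_tendstoD(1)[OF lim]) simp
    then show False
      using freq unfolding frequently_def not_le by blast
  qed
  then show ?thesis using s by simp
qed

definition branching :: "real set \<Rightarrow> real \<Rightarrow> real set \<Rightarrow> real \<Rightarrow> bool" where
  "branching D l G y \<longleftrightarrow> (\<exists>b\<in>D. \<exists>c\<in>D. b \<noteq> c \<and> y / l - b \<in> G \<and> y / l - c \<in> G)"

lemma branchingI:
  "b \<in> D \<Longrightarrow> c \<in> D \<Longrightarrow> b \<noteq> c \<Longrightarrow> y / l - b \<in> G \<Longrightarrow> y / l - c \<in> G \<Longrightarrow> branching D l G y"
  unfolding branching_def by blast

text \<open>
  The words that keep the remainder in \<open>G\<close> satisfy the hypothesis of the binary tree lemma: extend
  such a word to a branching point and then append either of the two digits available there.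
  The limiting sequences represent \<open>x\<close> because their remainders return to \<open>G\<close> infinitely often.
\<close>

lemma continuum_expansions:
  assumes l: "0 < l" "l < 1" and D: "finite D" and G: "bounded G" "x \<in> G"
    and reach: "\<And>w. w \<in> lists D \<Longrightarrow> remainder l x w \<in> G \<Longrightarrow> \<exists>v\<in>lists D. branching D l G (remainder l x (w @ v))"
  shows "expansions D l x \<approx> (UNIV :: nat set set)"
proof (rule lepoll_antisym)
  have "expansions D l x \<subseteq> {e. \<forall>n. e n \<in> D}" by (auto simp: expansions_def)
  then show "expansions D l x \<lesssim> (UNIV :: nat set set)"
    using sequences_lepoll[OF countable_finite[OF D]] by (rule lepoll_trans[OF subset_imp_lepoll])
  define Q where "Q = {w \<in> lists D. remainder l x w \<in> G}"
  have "(UNIV :: nat set set) \<lesssim> {e. \<forall>k. \<exists>n\<ge>k. map e [0..<n] \<in> Q}"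
  proof (rule split_tree_lepoll)
    show "[] \<in> Q" using G by (simp add: Q_def)
  next
    fix w assume w: "w \<in> Q"
    then obtain v where v: "v \<in> lists D" "branching D l G (remainder l x (w @ v))"
      using reach[of w] unfolding Q_def by blast
    then obtain b c where bc: "b \<in> D" "c \<in> D" "b \<noteq> c"
        "remainder l x (w @ v) / l - b \<in> G" "remainder l x (w @ v) / l - c \<in> G"
      by (auto simp: branching_def)
    then show "\<exists>u v. length u = length v \<and> u \<noteq> v \<and> w @ u \<in> Q \<and> w @ v \<in> Q"
      using w v by (intro exI[of _ "v @ [b]"] exI[of _ "v @ [c]"]) (auto simp: Q_def)
  qed
  moreover have "{e. \<forall>k. \<exists>n\<ge>k. map e [0..<n] \<in> Q} \<subseteq> expansions D l x"
  proof
    fix e assume "e \<in> {e. \<forall>k. \<exists>n\<ge>k. map e [0..<n] \<in> Q}"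
    then have e: "\<And>k. \<exists>n\<ge>k. map e [0..<n] \<in> Q" by blast
    have eD: "e n \<in> D" for n
      using e[of "Suc n"] by (auto simp: Q_def Suc_le_eq)
    obtain C where C: "\<And>y. y \<in> G \<Longrightarrow> \<bar>y\<bar> \<le> C" using G(1) by (auto simp: bounded_iff)
    have "(\<lambda>n. e n * l ^ Suc n) sums x"
      by (rule sums_if_remainders_recur[OF l D eD C]) (use e in \<open>auto simp: Q_def\<close>)
    then show "e \<in> expansions D l x" using eD by (simp add: expansions_def)
  qed
  ultimately show "(UNIV :: nat set set) \<lesssim> expansions D l x"
    using lepoll_trans[OF _ subset_imp_lepoll] by blast
qed

text \<open>
  The right-hand side describes the image of \<open>(L, R)\<close> under the contraction \<open>z \<mapsto> l (z + d)\<close>.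
\<close>

lemma step_in_interval_iff:
  fixes l :: real assumes "0 < l"
  shows "y / l - d \<in> {L<..<R} \<longleftrightarrow> l * (L + d) < y \<and> y < l * (R + d)"
  using assms by (auto simp: field_simps)

section \<open>Two digits with a ratio close to 1\<close>

text \<open>
  With \<open>W = l (c - b)\<close>, the points at distance more than \<open>W\<close> from both endpoints are branching.
  At distance at most \<open>W\<close> from an endpoint, the digit fixing that endpoint moves the point away by
  the factor \<open>1 / l\<close>, to a distance of at most \<open>W / l\<close>.  Since \<open>l + l\<^sup>2 > 1\<close> means
  \<open>W / l + W < R - L\<close>, the image stays more than \<open>W\<close> away from the other endpoint.
\<close>

lemma reach_branching_two_digits:
  fixes l :: real
  assumes l: "0 < l" "l < 1" "1 < l + l\<^sup>2"
    and D: "b \<in> D" "c \<in> D" "b < c"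
    and L: "l * (L + b) = L" and R: "l * (R + c) = R"
    and y: "y \<in> {L<..<R}"
  shows "\<exists>v\<in>lists D. branching D l {L<..<R} (remainder l y v)"
proof -
  define W where "W = l * (c - b)"
  have W: "W > 0" using l D by (simp add: W_def)
  have M: "(R - L) * (1 - l) = W"
    using L R by (simp add: W_def algebra_simps)
  have wide: "W / l + W < R - L"
  proof -
    have "(W / l + W) * (1 - l) * l = W * (1 - l\<^sup>2)"
      using l by (simp add: field_simps power2_eq_square)
    also have "\<dots> < W * l" using W l by simp
    also have "\<dots> = (R - L) * (1 - l) * l" using M by simp
    finally show ?thesis using l by (simp add: mult_less_cancel_right_pos)
  qed
  have middle: "\<exists>v\<in>lists D. branching D l {L<..<R} (remainder l y v)" if "W < y - L" "W < R - y" for y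
  proof -
    have "y / l - b \<in> {L<..<R}" "y / l - c \<in> {L<..<R}"
      using that L R W unfolding step_in_interval_iff[OF l(1)] by (simp_all add: W_def algebra_simps)
    then have "branching D l {L<..<R} y"
      using D by (intro branchingI[of b D c]) simp_all
    then show ?thesis by (intro bexI[of _ "[]"]) simp_all
  qed
  \<comment> \<open>\<open>n\<close> bounds the number of steps that are needed to get away from the nearer endpoint.\<close>
  have main: "\<exists>v\<in>lists D. branching D l {L<..<R} (remainder l y v)"
    if "W * l ^ n < y - L" "W * l ^ n < R - y" for n y
    using that
  proof (induction n arbitrary: y)
    case 0
    then show ?case using middle by simp
  next
    case (Suc n)
    have ln: "W * l ^ n \<le> W" using W l by (simp add: power_le_one)
    have step: "\<exists>v\<in>lists D. branching D l {L<..<R} (remainder l y v)"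
      if d: "d \<in> D" "W * l ^ n < (y / l - d) - L" "W * l ^ n < R - (y / l - d)" for d
    proof -
      obtain v where "v \<in> lists D" "branching D l {L<..<R} (remainder l (y / l - d) v)"
        using Suc.IH[OF d(2,3)] by blast
      then show ?thesis using d(1) by (intro bexI[of _ "d # v"]) auto
    qed
    consider "y - L \<le> W" | "R - y \<le> W" | "W < y - L" "W < R - y" by linarith
    then show ?case
    proof cases
      case 1
      have *: "y / l - b - L = (y - L) / l"
        using L l by (simp add: field_simps)
      have "W * l ^ n < (y - L) / l" using Suc.prems l by (simp add: field_simps)
      moreover have "(y - L) / l \<le> W / l" using 1 l by (simp add: divide_right_mono)
      ultimately show ?thesis
        using * wide ln by (intro step[OF D(1)]) linarith+
    next
      case 2
      have *: "R - (y / l - c) = (R - y) / l"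
        using R l by (simp add: field_simps)
      have "W * l ^ n < (R - y) / l" using Suc.prems l by (simp add: field_simps)
      moreover have "(R - y) / l \<le> W / l" using 2 l by (simp add: divide_right_mono)
      ultimately show ?thesis
        using * wide ln by (intro step[OF D(2)]) linarith+
    next
      case 3
      then show ?thesis by (rule middle)
    qed
  qed
  have "(\<lambda>n. W * l ^ n) \<longlonglongrightarrow> 0"
    using l by (intro tendsto_mult_right_zero LIMSEQ_power_zero) auto
  then have "\<forall>\<^sub>F n in sequentially. W * l ^ n < min (y - L) (R - y)"
    by (rule order_tendstoD) (use y in auto)
  then obtain n where "W * l ^ n < min (y - L) (R - y)"
    by (auto simp: eventually_sequentially)
  then show ?thesis by (intro main[of n]) auto
qed

section \<open>Points that never branch\<close>

definition branchless :: "real set \<Rightarrow> real \<Rightarrow> real set \<Rightarrow> real set" where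
  "branchless D l G = {z \<in> G. \<forall>v\<in>lists D. \<not> branching D l G (remainder l z v)}"

lemma branchless_step:
  assumes "z \<in> branchless D l G" "d \<in> D" "z / l - d \<in> G"
  shows "z / l - d \<in> branchless D l G"
  unfolding branchless_def
proof (intro CollectI conjI ballI)
  fix v assume "v \<in> lists D"
  then have "d # v \<in> lists D" using assms(2) by simp
  then have "\<not> branching D l G (remainder l z (d # v))" using assms(1) unfolding branchless_def by blast
  then show "\<not> branching D l G (remainder l (z / l - d) v)" by simp
qed (use assms in simp)

text \<open>
  The positions \<open>l (L + a\<^sub>j)\<close> and \<open>l (R + a\<^sub>j)\<close> are the ends of the interval on which the digit
  \<open>a\<^sub>j\<close> is admissible, and \<open>h\<close> bounds from below the overlap of two such consecutive intervals.
  A subinterval of \<open>(L, R)\<close> either lies in one of these intervals or contains the overlap of two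
  consecutive ones.  In the latter case a segment of length \<open>h / 2\<close> inside the overlap is a hole.  In the
  former the interval is magnified by \<open>1 / l\<close>, which can happen only finitely often; pulling back a hole of the
  image preserves the proportion because all maps are affine, and yields a hole again because
  \<open>branchless\<close> is invariant under admissible steps.
\<close>

lemma branchless_porous:
  fixes a :: "nat \<Rightarrow> real" and m :: nat
  defines "D \<equiv> a ` {1..m}"
  assumes l: "0 < l" "l < 1" and m: "m \<ge> 1"
    and L: "l * (L + a 1) = L" and R: "l * (R + a m) = R" and LR: "L < R"
    and mono: "\<And>j. 1 \<le> j \<Longrightarrow> j < m \<Longrightarrow> a j < a (Suc j)"
    and overlap: "\<And>j. 1 \<le> j \<Longrightarrow> j < m \<Longrightarrow> l * (L + a (Suc j)) + h \<le> l * (R + a j)"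
    and h: "0 < h" and uv: "L \<le> u" "u < v" "v \<le> R"
  shows "\<exists>p q. u < p \<and> q < v \<and> h / (2 * (R - L)) * (v - u) \<le> q - p \<and>
           {p..q} \<inter> branchless D l {L<..<R} = {}"
proof -
  let ?E = "branchless D l {L<..<R}"
  have base: "\<exists>p q. u < p \<and> q < v \<and> h / (2 * (R - L)) * (v - u) \<le> q - p \<and> {p..q} \<inter> ?E = {}"
    if uv: "L \<le> u" "u < v" "v \<le> R"
      and j: "1 \<le> j" "j < m" "u < l * (L + a (Suc j))" "l * (R + a j) < v" for u v j
  proof (intro exI conjI)
    \<comment> \<open>The margin \<open>h / 4\<close> keeps the closed hole strictly inside \<open>(u, v)\<close>, so that a point which
      a later pull-back maps into the hole has its image in the open interval \<open>(L, R)\<close>.\<close>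
    let ?p = "l * (L + a (Suc j)) + h / 4" and ?q = "l * (L + a (Suc j)) + 3 * h / 4"
    have o: "l * (L + a (Suc j)) + h \<le> l * (R + a j)" by (rule overlap) fact+
    show "u < ?p" using j h by linarith
    show "?q < v" using j o h by linarith
    have "(v - u) / (R - L) \<le> 1" using uv LR by simp
    then have "h / 2 * ((v - u) / (R - L)) \<le> h / 2 * 1"
      using h by (intro mult_left_mono) auto
    then show "h / (2 * (R - L)) * (v - u) \<le> ?q - ?p" by simp
    show "{?p..?q} \<inter> ?E = {}"
    proof (intro equals0I, elim IntE)
      fix z assume z: "z \<in> {?p..?q}" "z \<in> ?E"
      have aj: "a j < a (Suc j)" by (rule mono) fact+
      then have "l * (L + a j) < l * (L + a (Suc j))" "l * (R + a j) < l * (R + a (Suc j))"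
        using l by simp_all
      then have "z / l - a j \<in> {L<..<R}" "z / l - a (Suc j) \<in> {L<..<R}"
        unfolding step_in_interval_iff[OF l(1)] using z(1) o h by auto
      moreover have "a j \<in> D" "a (Suc j) \<in> D" using j by (auto simp: D_def)
      ultimately have "branching D l {L<..<R} z"
        using aj by (intro branchingI[of "a j" D "a (Suc j)"]) simp_all
      then show False using z(2) by (auto simp: branchless_def dest: bspec[of _ _ "[]"])
    qed
  qed
  have dichotomy: "(\<exists>j. 1 \<le> j \<and> j \<le> m \<and> l * (L + a j) \<le> u \<and> v \<le> l * (R + a j)) \<or>
      (\<exists>j. 1 \<le> j \<and> j < m \<and> u < l * (L + a (Suc j)) \<and> l * (R + a j) < v)"
    if uv: "L \<le> u" "u < v" "v \<le> R" for u v
  proof -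
    \<comment> \<open>Take the first digit whose interval reaches \<open>v\<close>: either this interval also starts no
      later than \<open>u\<close>, or its overlap with the preceding interval lies inside \<open>(u, v)\<close>.\<close>
    let ?P = "\<lambda>j. 1 \<le> j \<and> v \<le> l * (R + a j)"
    define j where "j = (LEAST j. ?P j)"
    have Pm: "?P m" using m R uv by simp
    then have j: "?P j" "j \<le> m"
      unfolding j_def by (rule LeastI, rule Least_le)
    show ?thesis
    proof (cases "l * (L + a j) \<le> u")
      case True then show ?thesis using j by blast
    next
      case False
      then have "j \<noteq> 1" using L uv by auto
      then obtain i where i: "j = Suc i" "1 \<le> i" using j(1) by (cases j) auto
      have "\<not> ?P i" using i(1) unfolding j_def by (intro not_less_Least) simp
      then show ?thesis using i j(2) False by (intro disjI2 exI[of _ i]) auto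
    qed
  qed
  have fits: "v - u \<le> l * (R - L)" if "l * (L + d) \<le> u" "v \<le> l * (R + d)" for u v d
    using that by (simp add: algebra_simps)
  have main: "\<exists>p q. u < p \<and> q < v \<and> h / (2 * (R - L)) * (v - u) \<le> q - p \<and> {p..q} \<inter> ?E = {}"
    if "L \<le> u" "u < v" "v \<le> R" "l ^ n * (R - L) \<le> v - u" for n u v
    using that
  proof (induction n arbitrary: u v)
    case 0
    have "l * (R - L) < R - L" using l LR by simp
    then have "\<not> (l * (L + a j) \<le> u \<and> v \<le> l * (R + a j))" for j
      using fits[of "a j" u v] 0(4) by auto
    then show ?case using dichotomy[OF 0(1-3)] base[OF 0(1-3)] by blast
  next
    case (Suc n)
    from dichotomy[OF Suc.prems(1-3)] show ?case
    proof (elim disjE exE conjE)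
      fix j assume j: "1 \<le> j" "j \<le> m" "l * (L + a j) \<le> u" "v \<le> l * (R + a j)"
      have "L \<le> u / l - a j" "u / l - a j < v / l - a j" "v / l - a j \<le> R"
        "l ^ n * (R - L) \<le> (v / l - a j) - (u / l - a j)"
        using j l Suc.prems by (simp_all add: field_simps)
      from Suc.IH[OF this] obtain p q where pq: "u / l - a j < p" "q < v / l - a j"
          "h / (2 * (R - L)) * ((v / l - a j) - (u / l - a j)) \<le> q - p" "{p..q} \<inter> ?E = {}"
        by blast
      show ?thesis
      proof (intro exI conjI)
        show "u < l * (p + a j)" "l * (q + a j) < v"
          using pq(1,2) l by (simp_all add: field_simps)
        have "l * (h / (2 * (R - L)) * ((v / l - a j) - (u / l - a j))) \<le> l * (q - p)"
          using pq(3) l by (intro mult_left_mono) auto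
        then show "h / (2 * (R - L)) * (v - u) \<le> l * (q + a j) - l * (p + a j)"
          using l by (simp add: algebra_simps)
        show "{l * (p + a j)..l * (q + a j)} \<inter> ?E = {}"
        proof (intro equals0I, elim IntE)
          fix z assume z: "z \<in> {l * (p + a j)..l * (q + a j)}" "z \<in> ?E"
          then have zpq: "z / l - a j \<in> {p..q}" using l by (simp add: field_simps)
          have "L < p" "q < R"
            using pq(1,2) \<open>L \<le> u / l - a j\<close> \<open>v / l - a j \<le> R\<close> by linarith+
          then have "z / l - a j \<in> {L<..<R}" using zpq by auto
          moreover have "a j \<in> D" using j by (auto simp: D_def)
          ultimately have "z / l - a j \<in> ?E" using z(2) by (intro branchless_step)
          then show False using zpq pq(4) by blast
        qed
      qed
    qed (use base[OF Suc.prems(1-3)] in blast)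
  qed
  have "(\<lambda>n. l ^ n * (R - L)) \<longlonglongrightarrow> 0"
    using l by (intro tendsto_mult_left_zero LIMSEQ_power_zero) auto
  then have "\<forall>\<^sub>F n in sequentially. l ^ n * (R - L) < v - u"
    by (rule order_tendstoD) (use uv in auto)
  then obtain n where "l ^ n * (R - L) < v - u"
    by (auto simp: eventually_sequentially)
  then show ?thesis using uv by (intro main[of _ _ n]) auto
qed

text \<open>
  If \<open>x\<close> does not have continuum many expansions, some remainder of it never leads to a branching
  point, and \<open>x\<close> is recovered from this remainder by an affine contraction that depends only on the
  word.
\<close>

lemma exceptional_subset:
  assumes l: "0 < l" "l < 1" and D: "finite D" and G: "bounded G"
  shows "{x \<in> G. \<not> expansions D l x \<approx> (UNIV :: nat set set)}
    \<subseteq> (\<Union>w\<in>lists D. (\<lambda>z. (\<Sum>n<length w. w ! n * l ^ Suc n) + l ^ length w * z) ` branchless D l G)"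
proof (intro subsetI, elim CollectE conjE)
  fix x assume x: "x \<in> G" "\<not> expansions D l x \<approx> (UNIV :: nat set set)"
  then obtain w where w: "w \<in> lists D" "remainder l x w \<in> G"
      "\<And>v. v \<in> lists D \<Longrightarrow> \<not> branching D l G (remainder l x (w @ v))"
    using continuum_expansions[OF l D G x(1)] by blast
  then have "remainder l x w \<in> branchless D l G" by (simp add: branchless_def)
  then show "x \<in> (\<Union>w\<in>lists D. (\<lambda>z. (\<Sum>n<length w. w ! n * l ^ Suc n) + l ^ length w * z) ` branchless D l G)"
    using remainder_eq[of l x w] w(1) l by (intro UN_I[of w] image_eqI) auto
qed

text \<open>
  Porosity makes \<open>branchless\<close> null for some exponent below 1.  There are only countably many words,
  and the affine maps belonging to them do not increase distances, so the union of the copies is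
  null for the same exponent.
\<close>

lemma exceptional_hausdorff_null:
  fixes a :: "nat \<Rightarrow> real" and m :: nat
  defines "D \<equiv> a ` {1..m}"
  assumes l: "0 < l" "l < 1" and m: "m \<ge> 2"
    and mono: "\<And>j. 1 \<le> j \<Longrightarrow> j < m \<Longrightarrow> a j < a (Suc j)"
    and L: "l * (L + a 1) = L" and R: "l * (R + a m) = R"
    and h: "0 < h" and overlap: "\<And>j. 1 \<le> j \<Longrightarrow> j < m \<Longrightarrow> l * (L + a (Suc j)) + h \<le> l * (R + a j)"
  shows "\<exists>s. 0 < s \<and> s < 1 \<and>
    hausdorff_measure s {x \<in> {L<..<R}. \<not> expansions D l x \<approx> (UNIV :: nat set set)} = 0"
proof -
  let ?E = "branchless D l {L<..<R}"
  have "h \<le> l * (R - L) - l * (a 2 - a 1)"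
    using overlap[of 1] m by (simp add: numeral_2_eq_2 algebra_simps)
  moreover have "l * (a 2 - a 1) > 0" using mono[of 1] m l by (simp add: numeral_2_eq_2)
  ultimately have hl: "h < l * (R - L)" by linarith
  then have LR: "L < R" using h l by (smt (verit) zero_less_mult_iff)
  then have "l * (R - L) < 1 * (R - L)" using l by (intro mult_strict_right_mono) auto
  then have "h < R - L" using hl by simp
  then have c: "0 < h / (2 * (R - L))" "h / (2 * (R - L)) < 1"
    using h LR by (auto simp: field_simps)
  obtain s where s: "0 < s" "s < 1" and E: "hausdorff_measure s (?E \<inter> {L<..<R}) = 0"
    using porous_hausdorff_null[OF c, of L R ?E]
      branchless_porous[where a = a and m = m, OF l _ L R LR mono overlap h, folded D_def] m by auto
  have "?E \<inter> {L<..<R} = ?E" by (auto simp: branchless_def)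
  then have E: "hausdorff_measure s ?E = 0" using E by simp
  have "hausdorff_measure s (\<Union>w\<in>lists D. (\<lambda>z. (\<Sum>n<length w. w ! n * l ^ Suc n) + l ^ length w * z) ` ?E) = 0"
  proof (rule hausdorff_measure_null_UN)
    show "countable (lists D)" by (intro countable_lists countable_finite) (simp add: D_def)
    fix w assume "w \<in> lists D"
    have "l ^ length w * \<bar>x - y\<bar> \<le> \<bar>x - y\<bar>" for x y
      using l by (intro mult_left_le_one_le) (auto simp: power_le_one)
    then have "dist (c + l ^ length w * x) (c + l ^ length w * y) \<le> dist x y" for c x y
      using l by (simp add: dist_real_def abs_mult flip: right_diff_distrib)
    then show "hausdorff_measure s ((\<lambda>z. (\<Sum>n<length w. w ! n * l ^ Suc n) + l ^ length w * z) ` ?E) = 0"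
      using s E by (intro hausdorff_measure_null_nonexpansive_image) auto
  qed
  moreover have "finite D" by (simp add: D_def)
  ultimately have "hausdorff_measure s {x \<in> {L<..<R}. \<not> expansions D l x \<approx> (UNIV :: nat set set)} = 0"
    using hausdorff_measure_null_mono exceptional_subset[OF l, of D "{L<..<R}"] by simp
  then show ?thesis using s by blast
qed

section \<open>Continuum many expansions\<close>

text \<open>
  The threshold \<open>7/10\<close> serves for all digit sets: beyond it \<open>l + l\<^sup>2 > 1\<close>.
\<close>

theorem proposition3p8:
  fixes m :: nat and a :: "nat \<Rightarrow> real"
  assumes "m \<ge> 2" and "strict_mono_on {1..m} a"
  shows "(\<exists>l0<1. \<forall>l\<in>{l0<..<1}. \<forall>x\<in>{l * a 1 / (1 - l)<..<l * a m / (1 - l)}.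
            expansions (a ` {1..m}) l x \<approx> (UNIV :: nat set set))
       \<and> (\<forall>l\<in>{0<..<1}.
            (MAX j\<in>{1..m - 1}. a (j + 1) - a j) < l * (a m - a 1) / (1 - l) \<longrightarrow>
            (AE x in lebesgue. x \<in> {l * a 1 / (1 - l)<..<l * a m / (1 - l)} \<longrightarrow>
               expansions (a ` {1..m}) l x \<approx> (UNIV :: nat set set))
          \<and> hausdorff_dim {x \<in> {l * a 1 / (1 - l)<..<l * a m / (1 - l)}.
               \<not> expansions (a ` {1..m}) l x \<approx> (UNIV :: nat set set)} < 1)"
proof (intro conjI exI[of _ "7/10 :: real"] ballI impI)
  let ?D = "a ` {1..m}"
  have fixed: "l * (l * d / (1 - l) + d) = l * d / (1 - l)" if "l < 1" for l d :: real
    using that by (simp add: field_simps)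
  have less: "a i < a j" if "1 \<le> i" "i < j" "j \<le> m" for i j
    using assms(2) that by (auto simp: strict_mono_on_def)
  show "(7/10 :: real) < 1" by simp
  {
    fix l x assume l: "l \<in> {7/10<..<1}" and x: "x \<in> {l * a 1 / (1 - l)<..<l * a m / (1 - l)}"
    have "(7/10)\<^sup>2 < l\<^sup>2" using l by (intro power_strict_mono) auto
    then have l': "0 < l" "l < 1" "1 < l + l\<^sup>2" using l by (auto simp: power2_eq_square)
    have D: "a 1 \<in> ?D" "a m \<in> ?D" "a 1 < a m" using assms(1) less[of 1 m] by auto
    show "expansions ?D l x \<approx> (UNIV :: nat set set)"
    proof (rule continuum_expansions[OF l'(1,2) _ _ x])
      fix w assume "remainder l x w \<in> {l * a 1 / (1 - l)<..<l * a m / (1 - l)}"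
      from reach_branching_two_digits[OF l' D fixed[OF l'(2)] fixed[OF l'(2)] this]
      show "\<exists>v\<in>lists ?D. branching ?D l {l * a 1 / (1 - l)<..<l * a m / (1 - l)} (remainder l x (w @ v))"
        by simp
    qed auto
  next
    fix l :: real
    assume l: "l \<in> {0<..<1}"
      and gaps: "(MAX j\<in>{1..m - 1}. a (j + 1) - a j) < l * (a m - a 1) / (1 - l)"
    let ?L = "l * a 1 / (1 - l)" and ?R = "l * a m / (1 - l)"
      and ?g = "MAX j\<in>{1..m - 1}. a (j + 1) - a j"
    let ?X = "{x \<in> {?L<..<?R}. \<not> expansions ?D l x \<approx> (UNIV :: nat set set)}"
    have RL: "?R - ?L = l * (a m - a 1) / (1 - l)"
      by (simp add: right_diff_distrib diff_divide_distrib)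
    \<comment> \<open>\<open>h\<close> is the length of the shortest overlap; it belongs to the largest gap.\<close>
    define h where "h = l * (?R - ?L - ?g)"
    have l': "0 < l" "l < 1" using l by auto
    have h: "0 < h" using gaps l' unfolding h_def RL by simp
    have overlap: "l * (?L + a (Suc j)) + h \<le> l * (?R + a j)" if "1 \<le> j" "j < m" for j
    proof -
      have "a (j + 1) - a j \<le> ?g"
        using that by (intro Max_ge) auto
      then have "l * (?L + a (Suc j) + (?R - ?L - ?g)) \<le> l * (?R + a j)"
        using l' by (intro mult_left_mono) auto
      then show ?thesis by (simp only: h_def distrib_left)
    qed
    obtain s where s: "0 < s" "s < 1" "hausdorff_measure s ?X = 0"
      using exceptional_hausdorff_null[where a = a and m = m, OF l' assms(1) less fixed[OF l'(2)] fixed[OF l'(2)] h overlap]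
      by auto
    have null: "?X \<in> null_sets lebesgue"
      using negligible_if_hausdorff_measure_null[of s ?X] s by (simp add: negligible_iff_null_sets)
    show "AE x in lebesgue. x \<in> {?L<..<?R} \<longrightarrow> expansions ?D l x \<approx> (UNIV :: nat set set)"
      by (rule AE_I'[OF null]) auto
    have "hausdorff_dim ?X \<le> ennreal s"
      unfolding hausdorff_dim_def using s by (intro INF_lower) auto
    also have "\<dots> < 1" using s by (simp add: ennreal_less_one_iff)
    finally show "hausdorff_dim ?X < 1" .
  }
qed

end
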